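(* Let $\mathbf A\in\mathbb R^{M\times K}$ and $\mathbf B\in\mathbb R^{K\times N}$ be matrices with no zero rows and no zero columns, and let $\mathbf A^{(t)},\mathbf B^{(t)},r_i^{(t)},s_j^{(t)}$ be produced by the repeated outside-inside scaling iteration. Then for all $i,j$ the sequence $$r_i^{(t)}s_j^{(t)}\,\|\mathbf A^{(t)}\|\,\|\mathbf B^{(t)}\|\qquad\text{for } t=0,1,\dots$$ is monotonically nonincreasing and converges linearly.
   Context: $\|\cdot\|$ is the max-norm, $\|\mathbf X\|=\max_{i,j}|x_{ij}|$. All quantities are in exact arithmetic. Repeated outside-inside scaling iteration: set $\mathbf A^{(0)}=\mathbf A$, $\mathbf B^{(0)}=\mathbf B$, $r_i^{(0)}=1$, $s_j^{(0)}=1$. Steps $1,2,\dots$ alternate between O (outside) steps and I (inside) steps; either type may come first. If step $t$ is an O step: let $r_i^{\prime(t)}=\max_k|a^{(t-1)}_{ik}|$ and $s_j^{\prime(t)}=\max_k|b^{(t-1)}_{kj}|$, and set $a^{(t)}_{ik}=a^{(t-1)}_{ik}/r_i^{\prime(t)}$, $b^{(t)}_{kj}=b^{(t-1)}_{kj}/s_j^{\prime(t)}$, $r_i^{(t)}=r_i^{(t-1)}r_i^{\prime(t)}$, $s_j^{(t)}=s_j^{(t-1)}s_j^{\prime(t)}$. If step $t$ is an I step: let $p_k^{\prime(t)}=\sqrt{\max_j|b^{(t-1)}_{kj}|\,/\,\max_i|a^{(t-1)}_{ik}|}$, and set $a^{(t)}_{ik}=a^{(t-1)}_{ik}p_k^{\prime(t)}$,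 $b^{(t)}_{kj}=b^{(t-1)}_{kj}/p_k^{\prime(t)}$, $r_i^{(t)}=r_i^{(t-1)}$, $s_j^{(t)}=s_j^{(t-1)}$. A sequence $x_t\to x_\star$ converges linearly if its distance to the limit is dominated by a geometrically decaying sequence, i.e. there are constants $c\ge0$ and $\rho\in(0,1)$ with $|x_t-x_\star|\le c\rho^t$ for all $t$. *)

theory Defs
  imports "HOL-Analysis.Analysis"
begin

definition max_norm :: "real^'n^'m \<Rightarrow> real" where
  "max_norm X = Max {\<bar>X $ i $ j\<bar> | i j. True}"

definition no_zero_rows :: "real^'n^'m \<Rightarrow> bool" where
  "no_zero_rows X \<longleftrightarrow> (\<forall>i. row i X \<noteq> 0)"

definition no_zero_columns :: "real^'n^'m \<Rightarrow> bool" where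
  "no_zero_columns X \<longleftrightarrow> (\<forall>j. column j X \<noteq> 0)"

text \<open>The state after a step: both scaled matrices, together with the accumulated row scale
  factors of the first and column scale factors of the second.\<close>

record ('m, 'k, 'n) scaling_state =
  mat_A :: "real^'k^'m"
  mat_B :: "real^'n^'k"
  scale_r :: "real^'m"
  scale_s :: "real^'n"

definition init_state ::
  "real^'k^'m \<Rightarrow> real^'n^'k \<Rightarrow> ('m::finite, 'k::finite, 'n::finite) scaling_state" where
  "init_state A B = \<lparr>mat_A = A, mat_B = B, scale_r = (\<chi> i. 1), scale_s = (\<chi> j. 1)\<rparr>"

definition outside_step ::
  "('m::finite, 'k::finite, 'n::finite) scaling_state \<Rightarrow> ('m, 'k, 'n) scaling_state" where
  "outside_step S =
    (let a = mat_A S; b = mat_B S;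
         r' = (\<lambda>i. MAX k. \<bar>a $ i $ k\<bar>);
         s' = (\<lambda>j. MAX k. \<bar>b $ k $ j\<bar>)
     in \<lparr>mat_A = (\<chi> i k. a $ i $ k / r' i),
         mat_B = (\<chi> k j. b $ k $ j / s' j),
         scale_r = (\<chi> i. scale_r S $ i * r' i),
         scale_s = (\<chi> j. scale_s S $ j * s' j)\<rparr>)"

definition inside_step ::
  "('m::finite, 'k::finite, 'n::finite) scaling_state \<Rightarrow> ('m, 'k, 'n) scaling_state" where
  "inside_step S =
    (let a = mat_A S; b = mat_B S;
         p' = (\<lambda>k. sqrt ((MAX j. \<bar>b $ k $ j\<bar>) / (MAX i. \<bar>a $ i $ k\<bar>)))
     in \<lparr>mat_A = (\<chi> i k. a $ i $ k * p' k),
         mat_B = (\<chi> k j. b $ k $ j / p' k),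
         scale_r = scale_r S,
         scale_s = scale_s S\<rparr>)"

text \<open>\<open>is_O t\<close> says that step \<open>t\<close> (for \<open>t \<ge> 1\<close>) is an O step; otherwise it is an I step.
  Step \<open>Suc t\<close> leads from state \<open>t\<close> to state \<open>Suc t\<close>, so the value \<open>is_O 0\<close> is never used.\<close>

definition alternating :: "(nat \<Rightarrow> bool) \<Rightarrow> bool" where
  "alternating is_O \<longleftrightarrow> (\<forall>t\<ge>1. is_O (Suc t) \<longleftrightarrow> \<not> is_O t)"

primrec scaling_iter ::
  "(nat \<Rightarrow> bool) \<Rightarrow> real^'k^'m \<Rightarrow> real^'n^'k \<Rightarrow> nat
    \<Rightarrow> ('m::finite, 'k::finite, 'n::finite) scaling_state" where
  "scaling_iter is_O A B 0 = init_state A B"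
| "scaling_iter is_O A B (Suc t) =
    (if is_O (Suc t) then outside_step (scaling_iter is_O A B t)
     else inside_step (scaling_iter is_O A B t))"

definition converges_linearly :: "(nat \<Rightarrow> real) \<Rightarrow> bool" where
  "converges_linearly x \<longleftrightarrow>
    (\<exists>L. x \<longlonglongrightarrow> L \<and>
      (\<exists>c \<rho>. 0 \<le> c \<and> 0 < \<rho> \<and> \<rho> < 1 \<and> (\<forall>t. \<bar>x t - L\<bar> \<le> c * \<rho> ^ t)))"

end

theory Submission
  imports Defs
begin

text \<open>In logarithmic coordinates, an I step followed by an O step is a max-plus map of the inside scaling
  \<open>u = ln p\<close>: it is piecewise affine, commutes with translations by constants, and is nonexpansive in
  the max-norm. After an O step the quantity in question is \<open>r\<^sub>i s\<^sub>j\<close>, whose logarithm \<open>z\<^sub>i\<^sub>j(u)\<close>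
  never increases, so \<open>F = (\<Sum>i j. z\<^sub>i\<^sub>j)\<close> is a Lyapunov function. Up to translation the orbit stays in a
  box, where the decrease of \<open>F\<close> in one step is a nonnegative piecewise affine function. By a
  Hoffman-type bound, the distance of \<open>u\<close> to a point where this decrease vanishes is at most a
  constant times the decrease at \<open>u\<close>; from such a point on, \<open>F\<close> stays constant, and by
  nonexpansiveness the total future decrease of \<open>F\<close> from \<open>u\<close> is at most a constant times the decrease
  in the next step. Hence \<open>F\<close>, and with it every \<open>z\<^sub>i\<^sub>j\<close>, converges geometrically.\<close>

section \<open>Piecewise affine functions\<close>

definition affine_form_on :: "'a::euclidean_space set \<Rightarrow> ('a \<Rightarrow> real) \<Rightarrow> bool" where
  "affine_form_on P g \<longleftrightarrow> (\<exists>a c. \<forall>x\<in>P. g x = a \<bullet> x + c)"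

definition piecewise_affine :: "('a::euclidean_space \<Rightarrow> real) \<Rightarrow> bool" where
  "piecewise_affine g \<longleftrightarrow>
    (\<exists>\<P>. finite \<P> \<and> \<Union>\<P> = UNIV \<and> (\<forall>P\<in>\<P>. polyhedron P \<and> affine_form_on P g))"

lemma affine_form_on_subset: "affine_form_on P g \<Longrightarrow> Q \<subseteq> P \<Longrightarrow> affine_form_on Q g"
  unfolding affine_form_on_def by blast

lemma affine_form_on_cong:
  "affine_form_on P g \<Longrightarrow> (\<And>x. x \<in> P \<Longrightarrow> h x = g x) \<Longrightarrow> affine_form_on P h"
  unfolding affine_form_on_def by metis

lemma affine_form_on_add:
  assumes "affine_form_on P g" "affine_form_on P h"
  shows "affine_form_on P (\<lambda>x. g x + h x)"
proof -
  obtain a c a' c' where "\<forall>x\<in>P. g x = a \<bullet> x + c" "\<forall>x\<in>P. h x = a' \<bullet> x + c'"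
    using assms unfolding affine_form_on_def by blast
  then have "\<forall>x\<in>P. g x + h x = (a + a') \<bullet> x + (c + c')"
    by (simp add: inner_add_left)
  then show ?thesis unfolding affine_form_on_def by blast
qed

lemma affine_form_on_cmult:
  assumes "affine_form_on P g"
  shows "affine_form_on P (\<lambda>x. r * g x)"
proof -
  obtain a c where "\<forall>x\<in>P. g x = a \<bullet> x + c"
    using assms unfolding affine_form_on_def by blast
  then have "\<forall>x\<in>P. r * g x = (r *\<^sub>R a) \<bullet> x + r * c"
    by (simp add: algebra_simps)
  then show ?thesis unfolding affine_form_on_def by blast
qed

text \<open>Within \<open>P\<close> the difference of the two functions is a single affine form, so
  the comparison cuts \<open>P\<close> by one halfspace.\<close>

lemma polyhedron_Int_le:
  assumes "polyhedron P" "affine_form_on P g" "affine_form_on P h"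
  shows "polyhedron (P \<inter> {x. g x \<le> h x})"
proof -
  have "affine_form_on P (\<lambda>x. g x + (-1) * h x)"
    by (intro affine_form_on_add affine_form_on_cmult assms)
  then obtain a c where "\<forall>x\<in>P. g x - h x = a \<bullet> x + c"
    unfolding affine_form_on_def by auto
  then have "P \<inter> {x. g x \<le> h x} = P \<inter> {x. a \<bullet> x \<le> - c}"
    by fastforce
  then show ?thesis
    using assms(1) by (simp add: polyhedron_halfspace_le)
qed

lemma piecewise_affine_common_refinement:
  assumes "piecewise_affine g" "piecewise_affine h"
  obtains \<P> where "finite \<P>" "\<Union>\<P> = UNIV"
    "\<And>P. P \<in> \<P> \<Longrightarrow> polyhedron P \<and> affine_form_on P g \<and> affine_form_on P h"
proof -
  obtain \<P> \<Q> where P: "finite \<P>" "\<Union>\<P> = UNIV" "\<forall>P\<in>\<P>. polyhedron P \<and> affine_form_on P g"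
    and Q: "finite \<Q>" "\<Union>\<Q> = UNIV" "\<forall>P\<in>\<Q>. polyhedron P \<and> affine_form_on P h"
    using assms unfolding piecewise_affine_def by blast
  show ?thesis
  proof
    let ?R = "(\<lambda>(P, Q). P \<inter> Q) ` (\<P> \<times> \<Q>)"
    show "finite ?R" using P(1) Q(1) by simp
    show "\<Union>?R = UNIV" using P(2) Q(2) by fastforce
    show "polyhedron P \<and> affine_form_on P g \<and> affine_form_on P h" if "P \<in> ?R" for P
      using that P(3) Q(3) by (auto intro: affine_form_on_subset)
  qed
qed

section \<open>Closure of piecewise affine functions under sums, multiples and maxima\<close>

lemma piecewise_affine_affine: "piecewise_affine (\<lambda>x. a \<bullet> x + c)"
  unfolding piecewise_affine_def affine_form_on_def
  by (rule exI[of _ "{UNIV}"]) auto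

lemma piecewise_affine_const: "piecewise_affine (\<lambda>x. c)"
  using piecewise_affine_affine[of 0 c] by simp

lemma piecewise_affine_component: "piecewise_affine (\<lambda>x. x $ k)"
  using piecewise_affine_affine[of "axis k (1::real)" 0] by (simp add: inner_axis')

lemma piecewise_affine_add:
  assumes "piecewise_affine g" "piecewise_affine h"
  shows "piecewise_affine (\<lambda>x. g x + h x)"
proof -
  obtain \<P> where "finite \<P>" "\<Union>\<P> = UNIV"
    "\<And>P. P \<in> \<P> \<Longrightarrow> polyhedron P \<and> affine_form_on P g \<and> affine_form_on P h"
    using piecewise_affine_common_refinement[OF assms] by blast
  then show ?thesis
    unfolding piecewise_affine_def using affine_form_on_add[of _ g h]
    by (intro exI[of _ \<P>]) simp
qed

lemma piecewise_affine_cmult: "piecewise_affine g \<Longrightarrow> piecewise_affine (\<lambda>x. r * g x)"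
  unfolding piecewise_affine_def using affine_form_on_cmult[of _ g r] by blast

lemma piecewise_affine_diff:
  assumes "piecewise_affine g" "piecewise_affine h"
  shows "piecewise_affine (\<lambda>x. g x - h x)"
  using piecewise_affine_add[OF assms(1) piecewise_affine_cmult[OF assms(2), of "-1"]] by simp

text \<open>Cutting each common piece along the comparison of \<open>g\<close> and \<open>h\<close>
  leaves parts on which the maximum is one of the two affine forms.\<close>

lemma piecewise_affine_max:
  assumes "piecewise_affine g" "piecewise_affine h"
  shows "piecewise_affine (\<lambda>x. max (g x) (h x))"
proof -
  obtain \<P> where P: "finite \<P>" "\<Union>\<P> = UNIV"
    "\<And>P. P \<in> \<P> \<Longrightarrow> polyhedron P \<and> affine_form_on P g \<and> affine_form_on P h"
    using piecewise_affine_common_refinement[OF assms] by blast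
  let ?\<Q> = "(\<lambda>P. P \<inter> {x. g x \<le> h x}) ` \<P> \<union> (\<lambda>P. P \<inter> {x. h x \<le> g x}) ` \<P>"
  have "finite ?\<Q>" using P(1) by simp
  moreover have "\<Union>?\<Q> = UNIV"
  proof -
    have "x \<in> \<Union>?\<Q>" for x
    proof -
      obtain P where "P \<in> \<P>" "x \<in> P" using P(2) by blast
      then show ?thesis using linear[of "g x" "h x"] by blast
    qed
    then show ?thesis by blast
  qed
  moreover have "polyhedron Q \<and> affine_form_on Q (\<lambda>x. max (g x) (h x))" if Q: "Q \<in> ?\<Q>" for Q
  proof -
    consider P where "P \<in> \<P>" "Q = P \<inter> {x. g x \<le> h x}"
      | P where "P \<in> \<P>" "Q = P \<inter> {x. h x \<le> g x}"
      using Q by blast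
    then show ?thesis
    proof cases
      case 1
      have "affine_form_on Q h"
        using P(3)[OF 1(1)] 1(2) affine_form_on_subset by blast
      then have "affine_form_on Q (\<lambda>x. max (g x) (h x))"
        by (rule affine_form_on_cong) (simp add: 1(2))
      moreover have "polyhedron Q"
        unfolding 1(2) using P(3)[OF 1(1)] by (intro polyhedron_Int_le) auto
      ultimately show ?thesis by simp
    next
      case 2
      have "affine_form_on Q g"
        using P(3)[OF 2(1)] 2(2) affine_form_on_subset by blast
      then have "affine_form_on Q (\<lambda>x. max (g x) (h x))"
        by (rule affine_form_on_cong) (simp add: 2(2))
      moreover have "polyhedron Q"
        unfolding 2(2) using P(3)[OF 2(1)] by (intro polyhedron_Int_le) auto
      ultimately show ?thesis by simp
    qed
  qed
  ultimately show ?thesis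
    unfolding piecewise_affine_def by (intro exI[of _ ?\<Q>] conjI ballI) simp_all
qed

lemma piecewise_affine_Max:
  assumes "finite I" "I \<noteq> {}" "\<And>i. i \<in> I \<Longrightarrow> piecewise_affine (g i)"
  shows "piecewise_affine (\<lambda>x. MAX i\<in>I. g i x)"
  using assms
proof (induction rule: finite_ne_induct)
  case (singleton i)
  then show ?case by simp
next
  case (insert i I)
  have "(MAX i\<in>insert i I. g i x) = max (g i x) (MAX i\<in>I. g i x)" for x
    using insert.hyps by simp
  then show ?case
    using piecewise_affine_max[OF insert.prems[OF insertI1] insert.IH[OF insert.prems[OF insertI2]]]
    by (simp only:)
qed

lemma piecewise_affine_sum:
  assumes "finite I" "\<And>i. i \<in> I \<Longrightarrow> piecewise_affine (g i)"
  shows "piecewise_affine (\<lambda>x. \<Sum>i\<in>I. g i x)"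
  using assms
proof (induction rule: finite_induct)
  case empty
  show ?case using piecewise_affine_const[of 0] by simp
next
  case (insert i I)
  have "(\<Sum>i\<in>insert i I. g i x) = g i x + (\<Sum>i\<in>I. g i x)" for x
    using insert.hyps by simp
  then show ?case
    using piecewise_affine_add[OF insert.prems[OF insertI1] insert.IH[OF insert.prems[OF insertI2]]]
    by (simp only:)
qed

text \<open>A Hoffman-type bound: in a convex combination of vertices, move the weight of the vertices
  where \<open>g\<close> is positive to a vertex where \<open>g\<close> vanishes.\<close>

lemma polytope_error_bound:
  assumes "polytope P" "affine_form_on P g" and nonneg: "\<And>x. x \<in> P \<Longrightarrow> 0 \<le> g x"
  shows "\<exists>C\<ge>0. \<forall>x\<in>P. (\<exists>y\<in>P. g y = 0 \<and> norm (x - y) \<le> C * g x) \<or> 1 \<le> C * g x"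
proof -
  obtain V where V: "finite V" "P = convex hull V"
    using assms(1) unfolding polytope_def by blast
  obtain a c where g: "\<And>x. x \<in> P \<Longrightarrow> g x = a \<bullet> x + c"
    using assms(2) unfolding affine_form_on_def by blast
  have VP: "v \<in> P" if "v \<in> V" for v
    using that V(2) hull_inc by fast
  \<comment> \<open>An affine form respects convex weights. This is used with \<open>p\<close> the
    identity, to evaluate \<open>g\<close> at a point, and with \<open>p\<close> the relocation of
    vertices below.\<close>
  have g_comb: "(\<Sum>v\<in>V. l v *\<^sub>R p v) \<in> P \<and> g (\<Sum>v\<in>V. l v *\<^sub>R p v) = (\<Sum>v\<in>V. l v * g (p v))"
    if l: "\<And>v. v \<in> V \<Longrightarrow> 0 \<le> l v" "sum l V = 1" and p: "\<And>v. v \<in> V \<Longrightarrow> p v \<in> P" for l p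
  proof
    show *: "(\<Sum>v\<in>V. l v *\<^sub>R p v) \<in> P"
      unfolding V(2) using V l p by (intro convex_sum) auto
    have "(\<Sum>v\<in>V. l v * g (p v)) = (\<Sum>v\<in>V. l v * (a \<bullet> p v)) + (\<Sum>v\<in>V. l v) * c"
      by (simp add: g p algebra_simps sum.distrib sum_distrib_left)
    also have "\<dots> = a \<bullet> (\<Sum>v\<in>V. l v *\<^sub>R p v) + c"
      using l by (simp add: inner_sum_right)
    finally show "g (\<Sum>v\<in>V. l v *\<^sub>R p v) = (\<Sum>v\<in>V. l v * g (p v))"
      using g[OF *] by simp
  qed
  have comb: "\<exists>l. (\<forall>v\<in>V. 0 \<le> l v) \<and> sum l V = 1 \<and> (\<Sum>v\<in>V. l v *\<^sub>R v) = x" if "x \<in> P" for x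
    using that V by (simp add: convex_hull_finite)
  show ?thesis
  proof (cases "\<exists>v\<in>V. g v = 0")
    case True
    then obtain w where w: "w \<in> V" "g w = 0" by blast
    define p where "p v = (if g v = 0 then v else w)" for v
    \<comment> \<open>A sum of nonnegative ratios bounds each of them. Vertices with
      \<open>g v = 0\<close> are not moved and contribute 0.\<close>
    define C where "C = (\<Sum>v\<in>V. norm (v - p v) / g v)"
    have pV: "p v \<in> P" "g (p v) = 0" if "v \<in> V" for v
      using that w VP by (auto simp: p_def)
    have terms: "0 \<le> norm (v - p v) / g v" if "v \<in> V" for v
      using nonneg VP that by simp
    have C: "norm (v - p v) \<le> C * g v" if v: "v \<in> V" for v
    proof (cases "g v = 0")
      case False
      then have "0 < g v" using nonneg[OF VP[OF v]] by simp
      moreover have "norm (v - p v) / g v \<le> C"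
        unfolding C_def using v terms V(1) by (intro member_le_sum) auto
      ultimately show ?thesis by (simp add: pos_divide_le_eq)
    qed (simp add: p_def)
    show ?thesis
    proof (intro exI[of _ C] conjI ballI)
      show "0 \<le> C" unfolding C_def using terms by (intro sum_nonneg) auto
      fix x assume "x \<in> P"
      then obtain l where l: "\<forall>v\<in>V. 0 \<le> l v" "sum l V = 1" "(\<Sum>v\<in>V. l v *\<^sub>R v) = x"
        using comb by blast
      let ?y = "\<Sum>v\<in>V. l v *\<^sub>R p v"
      have gx: "g x = (\<Sum>v\<in>V. l v * g v)"
        using g_comb[of l "\<lambda>v. v"] l VP by auto
      have y: "?y \<in> P" "g ?y = 0"
        using g_comb[of l p] l pV by auto
      have "norm (x - ?y) = norm (\<Sum>v\<in>V. l v *\<^sub>R (v - p v))"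
        by (simp add: l(3)[symmetric] sum_subtractf algebra_simps)
      also have "\<dots> \<le> (\<Sum>v\<in>V. l v * (C * g v))"
        using l(1) C by (intro sum_norm_le) (auto intro!: mult_left_mono)
      also have "\<dots> = C * g x"
        by (simp add: gx sum_distrib_left algebra_simps)
      finally show "(\<exists>y\<in>P. g y = 0 \<and> norm (x - y) \<le> C * g x) \<or> 1 \<le> C * g x"
        using y by blast
    qed
  next
    case False
    then have pos: "0 < g v" if "v \<in> V" for v
      using that nonneg[OF VP[OF that]] by force
    \<comment> \<open>No vertex is a zero, so \<open>g\<close> is bounded away from 0 on
      \<open>P\<close>: the second alternative.\<close>
    define C where "C = (\<Sum>v\<in>V. 1 / g v)"
    have C: "1 \<le> C * g v" if v: "v \<in> V" for v
    proof -
      have "1 / g v \<le> C"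
        unfolding C_def using v pos V(1) by (intro member_le_sum) (auto simp: less_imp_le)
      then show ?thesis using pos[OF v] by (simp add: pos_divide_le_eq)
    qed
    show ?thesis
    proof (intro exI[of _ C] conjI ballI)
      show "0 \<le> C" unfolding C_def using pos by (intro sum_nonneg) (auto simp: less_imp_le)
      fix x assume "x \<in> P"
      then obtain l where l: "\<forall>v\<in>V. 0 \<le> l v" "sum l V = 1" "(\<Sum>v\<in>V. l v *\<^sub>R v) = x"
        using comb by blast
      have gx: "g x = (\<Sum>v\<in>V. l v * g v)"
        using g_comb[of l "\<lambda>v. v"] l VP by auto
      have "1 = (\<Sum>v\<in>V. l v * 1)" using l by simp
      also have "\<dots> \<le> (\<Sum>v\<in>V. l v * (C * g v))"
        using l C by (intro sum_mono mult_left_mono) auto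
      also have "\<dots> = C * g x"
        by (simp add: gx sum_distrib_left algebra_simps)
      finally show "(\<exists>y\<in>P. g y = 0 \<and> norm (x - y) \<le> C * g x) \<or> 1 \<le> C * g x"
        by blast
    qed
  qed
qed

text \<open>Each piece meets \<open>K\<close> in a polytope, where the previous bound applies. The
  alternative \<open>1 \<le> C * g x\<close> serves the pieces without a zero of \<open>g\<close>,
  and the sum of the constants works for all pieces.\<close>

lemma piecewise_affine_error_bound:
  assumes "piecewise_affine g" and nonneg: "\<And>x. 0 \<le> g x" and K: "polytope K"
  shows "\<exists>C\<ge>0. \<forall>x\<in>K. (\<exists>y. g y = 0 \<and> norm (x - y) \<le> C * g x) \<or> 1 \<le> C * g x"
proof -
  obtain \<P> where P: "finite \<P>" "\<Union>\<P> = UNIV" "\<forall>P\<in>\<P>. polyhedron P \<and> affine_form_on P g"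
    using assms(1) unfolding piecewise_affine_def by blast
  have "\<exists>C\<ge>0. \<forall>x\<in>P \<inter> K. (\<exists>y. g y = 0 \<and> norm (x - y) \<le> C * g x) \<or> 1 \<le> C * g x"
    if "P \<in> \<P>" for P
  proof -
    have "polytope (P \<inter> K)"
      using that P(3) K
      by (metis bounded_Int polyhedron_Int polytope_eq_bounded_polyhedron)
    moreover have "affine_form_on (P \<inter> K) g"
      using that P(3) affine_form_on_subset by blast
    ultimately have "\<exists>C\<ge>0. \<forall>x\<in>P \<inter> K.
        (\<exists>y\<in>P \<inter> K. g y = 0 \<and> norm (x - y) \<le> C * g x) \<or> 1 \<le> C * g x"
      using nonneg by (rule polytope_error_bound)
    then show ?thesis by blast
  qed
  then obtain C where C: "\<And>P. P \<in> \<P> \<Longrightarrow> 0 \<le> C P"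
    "\<And>P x. \<lbrakk>P \<in> \<P>; x \<in> P \<inter> K\<rbrakk> \<Longrightarrow>
      (\<exists>y. g y = 0 \<and> norm (x - y) \<le> C P * g x) \<or> 1 \<le> C P * g x"
    by metis
  show ?thesis
  proof (intro exI[of _ "sum C \<P>"] conjI ballI)
    show "0 \<le> sum C \<P>" using C(1) by (intro sum_nonneg)
    fix x assume "x \<in> K"
    obtain Q where Q: "Q \<in> \<P>" "x \<in> Q" using P(2) by blast
    have "C Q \<le> sum C \<P>" using Q C(1) P(1) by (intro member_le_sum) auto
    then have "C Q * g x \<le> sum C \<P> * g x" using nonneg by (intro mult_right_mono)
    then show "(\<exists>y. g y = 0 \<and> norm (x - y) \<le> sum C \<P> * g x) \<or> 1 \<le> sum C \<P> * g x"
      using C(2)[of Q x] Q \<open>x \<in> K\<close> by force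
  qed
qed

section \<open>The max-plus map of the iteration\<close>

lemma Max_image_le_iff:
  fixes g :: "'a \<Rightarrow> real"
  shows "finite I \<Longrightarrow> I \<noteq> {} \<Longrightarrow> (MAX i\<in>I. g i) \<le> c \<longleftrightarrow> (\<forall>i\<in>I. g i \<le> c)"
  by simp

lemma Max_image_ge:
  fixes g :: "'a \<Rightarrow> real"
  shows "finite I \<Longrightarrow> i \<in> I \<Longrightarrow> g i \<le> (MAX i\<in>I. g i)"
  by simp

lemma Max_image_nonexpansive:
  fixes g h :: "'a \<Rightarrow> real"
  assumes "finite I" "I \<noteq> {}" "\<And>i. i \<in> I \<Longrightarrow> \<bar>g i - h i\<bar> \<le> d"
  shows "\<bar>(MAX i\<in>I. g i) - (MAX i\<in>I. h i)\<bar> \<le> d"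
proof -
  have "(MAX i\<in>I. g i) \<le> (MAX i\<in>I. h i) + d"
    unfolding Max_image_le_iff[OF assms(1,2)]
    using assms(3) Max_image_ge[OF assms(1), of _ h] by (smt (verit))
  moreover have "(MAX i\<in>I. h i) \<le> (MAX i\<in>I. g i) + d"
    unfolding Max_image_le_iff[OF assms(1,2)]
    using assms(3) Max_image_ge[OF assms(1), of _ g] by (smt (verit))
  ultimately show ?thesis by linarith
qed

text \<open>The logarithm is increasing on positive numbers; zero entries correspond to minus
  infinity and are left out of the right-hand maximum.\<close>

lemma Max_image_eq_exp:
  fixes g :: "'a::finite \<Rightarrow> real"
  assumes "\<And>k. 0 \<le> g k" "g k0 \<noteq> 0"
  shows "(MAX k. g k) = exp (MAX k\<in>{k. g k \<noteq> 0}. ln (g k))"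
proof -
  let ?I = "{k. g k \<noteq> 0}"
  have I: "finite ?I" "?I \<noteq> {}" using assms(2) by auto
  obtain k1 where k1: "k1 \<in> ?I" "(MAX k\<in>?I. ln (g k)) = ln (g k1)"
    using Max_in[of "(\<lambda>k. ln (g k)) ` ?I"] I by fastforce
  have pos: "0 < g k1" using k1(1) assms(1)[of k1] by simp
  have "g k \<le> g k1" for k
  proof (cases "g k = 0")
    case False
    then have "ln (g k) \<le> ln (g k1)"
      using k1(2) Max_image_ge[OF I(1), of k "\<lambda>k. ln (g k)"] by simp
    then show ?thesis using False assms(1)[of k] pos by simp
  qed (use pos in simp)
  then have "(MAX k. g k) = g k1" by (intro Max_eqI) auto
  then show ?thesis using k1(2) pos by simp
qed

text \<open>An O step normalises row maxima of the first matrix and column maxima of the second, an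
  I step acts on the other two kinds. This form and its transpose tie them all to the
  max-norm.\<close>

lemma max_norm_rows: "max_norm X = (MAX i. MAX j. \<bar>X $ i $ j\<bar>)"
proof -
  have "{\<bar>X $ i $ j\<bar> | i j. True} = (\<lambda>p. \<bar>X $ fst p $ snd p\<bar>) ` UNIV"
    by (auto simp: image_iff) blast
  then have "max_norm X = (MAX p. \<bar>X $ fst p $ snd p\<bar>)" by (simp add: max_norm_def)
  also have "\<dots> = (MAX i. MAX j. \<bar>X $ i $ j\<bar>)"
  proof (rule antisym)
    show "(MAX p. \<bar>X $ fst p $ snd p\<bar>) \<le> (MAX i. MAX j. \<bar>X $ i $ j\<bar>)"
      by (subst Max_image_le_iff) (auto simp: Max_ge_iff)
    show "(MAX i. MAX j. \<bar>X $ i $ j\<bar>) \<le> (MAX p. \<bar>X $ fst p $ snd p\<bar>)"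
      using Max_image_ge[of UNIV _ "\<lambda>p. \<bar>X $ fst p $ snd p\<bar>"]
      by (subst Max_image_le_iff; force)+
  qed
  finally show ?thesis .
qed

lemma max_norm_transpose: "max_norm (transpose X) = max_norm X"
  unfolding max_norm_def transpose_def by (rule arg_cong[where f = Max]) auto

lemma max_norm_columns: "max_norm X = (MAX j. MAX i. \<bar>X $ i $ j\<bar>)"
  using max_norm_rows[of "transpose X"] unfolding max_norm_transpose by (simp add: transpose_def)

text \<open>Monotonicity fills the gaps between the indices \<open>t0 + 2 * n\<close>, and a factor
  \<open>q\<close> per two steps becomes \<open>sqrt q\<close> per step.\<close>

lemma converges_linearly_of_every_second:
  assumes dec: "decseq x" and L_le: "\<And>n. L \<le> x (t0 + 2 * n)"
    and decay: "\<And>n. x (t0 + 2 * n) - L \<le> c * q ^ n"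
    and c: "0 \<le> c" and q: "0 < q" "q < 1"
  shows "converges_linearly x"
proof -
  define r where "r = sqrt q"
  have r: "0 < r" "r < 1" and rq: "r ^ (2 * n) = q ^ n" for n
    using q by (auto simp: r_def power_mult)
  have L: "L \<le> x t" for t
    using L_le[of t] decseqD[OF dec, of t "t0 + 2 * t"] by simp
  \<comment> \<open>The divisor pays for the offset of \<open>t\<close> from \<open>2 * n\<close>,
    and \<open>x 0 - L\<close> covers the indices before \<open>t0\<close>.\<close>
  define d where "d = (c + (x 0 - L)) / r ^ (t0 + 1)"
  have d0: "0 \<le> d" unfolding d_def using c L r by simp
  have bound: "x t - L \<le> d * r ^ t" for t
  proof -
    \<comment> \<open>For \<open>t < t0\<close> truncated subtraction gives
      \<open>n = 0\<close>.\<close>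
    define n where "n = (t - t0) div 2"
    have t: "t \<le> 2 * n + (t0 + 1)" unfolding n_def by linarith
    have "x t - L \<le> (c + (x 0 - L)) * q ^ n"
    proof (cases "t0 \<le> t")
      case True
      then have "t0 + 2 * n \<le> t" unfolding n_def by linarith
      then have "x t - L \<le> c * q ^ n"
        using decseqD[OF dec, of "t0 + 2 * n" t] decay[of n] by simp
      also have "\<dots> \<le> (c + (x 0 - L)) * q ^ n"
        using L q by (intro mult_right_mono) auto
      finally show ?thesis .
    next
      case False
      then show ?thesis
        using decseqD[OF dec, of 0 t] c by (simp add: n_def)
    qed
    also have "\<dots> = d * r ^ (2 * n + (t0 + 1))"
      using r by (simp add: d_def power_add rq)
    also have "\<dots> \<le> d * r ^ t"
      using t r d0 by (intro mult_left_mono power_decreasing) auto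
    finally show ?thesis .
  qed
  have abs: "\<bar>x t - L\<bar> \<le> d * r ^ t" for t using bound L[of t] by simp
  have "(\<lambda>t. d * r ^ t) \<longlonglongrightarrow> d * 0"
    using r by (intro tendsto_mult_left LIMSEQ_realpow_zero) auto
  then have "(\<lambda>t. x t - L) \<longlonglongrightarrow> 0"
    using abs by (intro Lim_null_comparison[of "\<lambda>t. x t - L" "\<lambda>t. d * r ^ t"]) auto
  then have "x \<longlonglongrightarrow> L" by (rule LIM_zero_cancel)
  then show ?thesis
    unfolding converges_linearly_def using d0 r abs by blast
qed

section \<open>Row and column maxima in logarithmic coordinates\<close>

locale scaling_pair =
  fixes A :: "real^'k^'m" and B :: "real^'n^'k"
  assumes A_row: "no_zero_rows A" and A_column: "no_zero_columns A"
    and B_row: "no_zero_rows B" and B_column: "no_zero_columns B"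
begin

text \<open>This and the next three facts ensure that the maxima below range over nonempty
  sets.\<close>

lemma A_row_ex: "\<exists>k. A $ i $ k \<noteq> 0"
  using A_row by (auto simp: no_zero_rows_def row_def vec_eq_iff)

lemma A_column_ex: "\<exists>i. A $ i $ k \<noteq> 0"
  using A_column by (auto simp: no_zero_columns_def column_def vec_eq_iff)

lemma B_row_ex: "\<exists>j. B $ k $ j \<noteq> 0"
  using B_row by (auto simp: no_zero_rows_def row_def vec_eq_iff)

lemma B_column_ex: "\<exists>k. B $ k $ j \<noteq> 0"
  using B_column by (auto simp: no_zero_columns_def column_def vec_eq_iff)

text \<open>With \<open>u = ln p\<close> the accumulated inside scaling, \<open>log_r u\<close> and \<open>log_s u\<close> are the logarithms
  of the outside scale factors after an O step, and \<open>log_p\<close> is the logarithm of the inside scaling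
  after an I step that starts from the outside factors \<open>exp \<rho>\<close> and \<open>exp \<sigma>\<close>.\<close>

definition log_r :: "real^'k \<Rightarrow> 'm \<Rightarrow> real" where
  "log_r u i = (MAX k\<in>{k. A $ i $ k \<noteq> 0}. ln \<bar>A $ i $ k\<bar> + u $ k)"

definition log_s :: "real^'k \<Rightarrow> 'n \<Rightarrow> real" where
  "log_s u j = (MAX k\<in>{k. B $ k $ j \<noteq> 0}. ln \<bar>B $ k $ j\<bar> - u $ k)"

text \<open>Logarithm of the largest modulus in column \<open>k\<close> once each row
  \<open>i\<close> of \<open>A\<close> is divided by \<open>exp (\<rho> i)\<close>, without inside
  scaling.\<close>

definition col_A :: "('m \<Rightarrow> real) \<Rightarrow> 'k \<Rightarrow> real" where
  "col_A \<rho> k = (MAX i\<in>{i. A $ i $ k \<noteq> 0}. ln \<bar>A $ i $ k\<bar> - \<rho> i)"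

definition row_B :: "('n \<Rightarrow> real) \<Rightarrow> 'k \<Rightarrow> real" where
  "row_B \<sigma> k = (MAX j\<in>{j. B $ k $ j \<noteq> 0}. ln \<bar>B $ k $ j\<bar> - \<sigma> j)"

definition log_p :: "('m \<Rightarrow> real) \<Rightarrow> ('n \<Rightarrow> real) \<Rightarrow> real^'k" where
  "log_p \<rho> \<sigma> = (\<chi> k. (row_B \<sigma> k - col_A \<rho> k) / 2)"

text \<open>One O step and the I step after it. The old \<open>u\<close> enters only through the new
  outside factors.\<close>

definition step_map :: "real^'k \<Rightarrow> real^'k" where
  "step_map u = log_p (log_r u) (log_s u)"

text \<open>This is the z of the overview; \<open>total\<close> is its F.\<close>

definition log_rs :: "real^'k \<Rightarrow> 'm \<Rightarrow> 'n \<Rightarrow> real" where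
  "log_rs u i j = log_r u i + log_s u j"

definition total :: "real^'k \<Rightarrow> real" where
  "total u = (\<Sum>i\<in>UNIV. \<Sum>j\<in>UNIV. log_rs u i j)"

lemma log_r_ge: "A $ i $ k \<noteq> 0 \<Longrightarrow> ln \<bar>A $ i $ k\<bar> + u $ k \<le> log_r u i"
  unfolding log_r_def by simp

lemma log_s_ge: "B $ k $ j \<noteq> 0 \<Longrightarrow> ln \<bar>B $ k $ j\<bar> - u $ k \<le> log_s u j"
  unfolding log_s_def by simp

lemma col_A_ge: "A $ i $ k \<noteq> 0 \<Longrightarrow> ln \<bar>A $ i $ k\<bar> - \<rho> i \<le> col_A \<rho> k"
  unfolding col_A_def by simp

lemma row_B_ge: "B $ k $ j \<noteq> 0 \<Longrightarrow> ln \<bar>B $ k $ j\<bar> - \<sigma> j \<le> row_B \<sigma> k"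
  unfolding row_B_def by simp

lemma log_r_le_iff: "log_r u i \<le> c \<longleftrightarrow> (\<forall>k. A $ i $ k \<noteq> 0 \<longrightarrow> ln \<bar>A $ i $ k\<bar> + u $ k \<le> c)"
  unfolding log_r_def using A_row_ex by (subst Max_image_le_iff) auto

lemma log_s_le_iff: "log_s u j \<le> c \<longleftrightarrow> (\<forall>k. B $ k $ j \<noteq> 0 \<longrightarrow> ln \<bar>B $ k $ j\<bar> - u $ k \<le> c)"
  unfolding log_s_def using B_column_ex by (subst Max_image_le_iff) auto

lemma col_A_le_iff: "col_A \<rho> k \<le> c \<longleftrightarrow> (\<forall>i. A $ i $ k \<noteq> 0 \<longrightarrow> ln \<bar>A $ i $ k\<bar> - \<rho> i \<le> c)"
  unfolding col_A_def using A_column_ex by (subst Max_image_le_iff) auto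

lemma row_B_le_iff: "row_B \<sigma> k \<le> c \<longleftrightarrow> (\<forall>j. B $ k $ j \<noteq> 0 \<longrightarrow> ln \<bar>B $ k $ j\<bar> - \<sigma> j \<le> c)"
  unfolding row_B_def using B_row_ex by (subst Max_image_le_iff) auto

text \<open>After an O step all moduli are at most 1, so \<open>a k + u $ k\<close> and
  \<open>b k - u $ k\<close> are at most 0. The I step replaces both by their mean
  \<open>(a k + b k) / 2\<close>, so neither outside factor grows.\<close>

lemma log_rs_step_map_le: "log_rs (step_map u) i j \<le> log_rs u i j"
proof -
  define a b where "a = col_A (log_r u)" and "b = row_B (log_s u)"
  have step_map: "step_map u $ k = (b k - a k) / 2" for k
    by (simp add: step_map_def log_p_def a_def b_def)
  have "a k \<le> - u $ k" for k
    unfolding a_def col_A_le_iff using log_r_ge by (smt (verit))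
  moreover have "b k \<le> u $ k" for k
    unfolding b_def row_B_le_iff using log_s_ge by (smt (verit))
  ultimately have ab: "a k + b k \<le> 0" for k
    by (smt (verit))
  \<comment> \<open>Both \<open>a k + step_map u $ k\<close> and \<open>b k - step_map u $ k\<close>
    equal \<open>(a k + b k) / 2\<close>.\<close>
  have A: "ln \<bar>A $ i $ k\<bar> + step_map u $ k \<le> log_r u i + (a k + b k) / 2" if "A $ i $ k \<noteq> 0" for k
    using col_A_ge[OF that, of "log_r u"] by (simp add: step_map a_def field_simps)
  have B: "ln \<bar>B $ k $ j\<bar> - step_map u $ k \<le> log_s u j + (a k + b k) / 2" if "B $ k $ j \<noteq> 0" for k
    using row_B_ge[OF that, of "log_s u"] by (simp add: step_map b_def field_simps)
  have "log_r (step_map u) i \<le> log_r u i"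
    unfolding log_r_le_iff using A ab by (fastforce intro: order_trans)
  moreover have "log_s (step_map u) j \<le> log_s u j"
    unfolding log_s_le_iff using B ab by (fastforce intro: order_trans)
  ultimately show ?thesis unfolding log_rs_def by simp
qed

lemma total_step_map_le: "total (step_map u) \<le> total u"
  unfolding total_def by (intro sum_mono log_rs_step_map_le)

lemma decseq_log_rs: "decseq (\<lambda>n. log_rs ((step_map ^^ n) u) i j)"
  by (rule decseq_SucI) (simp add: log_rs_step_map_le)

section \<open>Nonexpansiveness and translation invariance\<close>

lemma log_r_nonexpansive:
  "(\<And>k. \<bar>u $ k - v $ k\<bar> \<le> d) \<Longrightarrow> \<bar>log_r u i - log_r v i\<bar> \<le> d"
  unfolding log_r_def using A_row_ex by (intro Max_image_nonexpansive) auto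

lemma log_s_nonexpansive:
  "(\<And>k. \<bar>u $ k - v $ k\<bar> \<le> d) \<Longrightarrow> \<bar>log_s u j - log_s v j\<bar> \<le> d"
  unfolding log_s_def using B_column_ex
  by (intro Max_image_nonexpansive) (auto simp: abs_minus_commute)

text \<open>Both maxima change by at most \<open>d\<close>, hence so does half their
  difference.\<close>

lemma step_map_nonexpansive:
  assumes "\<And>k. \<bar>u $ k - v $ k\<bar> \<le> d"
  shows "\<bar>step_map u $ k - step_map v $ k\<bar> \<le> d"
proof -
  have "\<bar>col_A (log_r u) k - col_A (log_r v) k\<bar> \<le> d"
    unfolding col_A_def using A_column_ex log_r_nonexpansive[OF assms]
    by (intro Max_image_nonexpansive) (auto simp: abs_minus_commute)
  moreover have "\<bar>row_B (log_s u) k - row_B (log_s v) k\<bar> \<le> d"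
    unfolding row_B_def using B_row_ex log_s_nonexpansive[OF assms]
    by (intro Max_image_nonexpansive) (auto simp: abs_minus_commute)
  ultimately show ?thesis unfolding step_map_def log_p_def by (simp add: abs_le_iff field_simps)
qed

lemma total_lipschitz:
  assumes "\<And>k. \<bar>u $ k - v $ k\<bar> \<le> d"
  shows "\<bar>total u - total v\<bar> \<le> real CARD('m) * real CARD('n) * (2 * d)"
proof -
  have "\<bar>log_rs u i j - log_rs v i j\<bar> \<le> 2 * d" for i j
    using log_r_nonexpansive[OF assms, of i] log_s_nonexpansive[OF assms, of j]
    unfolding log_rs_def by linarith
  then have "(\<Sum>i\<in>UNIV. \<Sum>j\<in>UNIV. \<bar>log_rs u i j - log_rs v i j\<bar>)
      \<le> (\<Sum>i\<in>(UNIV::'m set). \<Sum>j\<in>(UNIV::'n set). 2 * d)"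
    by (intro sum_mono)
  moreover have "\<bar>total u - total v\<bar> \<le> (\<Sum>i\<in>UNIV. \<Sum>j\<in>UNIV. \<bar>log_rs u i j - log_rs v i j\<bar>)"
    unfolding total_def sum_subtractf[symmetric]
    by (intro order_trans[OF sum_abs] sum_mono sum_abs)
  ultimately show ?thesis by simp
qed

lemma iterate_nonexpansive:
  assumes "\<And>k. \<bar>u $ k - v $ k\<bar> \<le> d"
  shows "\<bar>(step_map ^^ n) u $ k - (step_map ^^ n) v $ k\<bar> \<le> d"
  using assms by (induction n arbitrary: k) (auto intro: step_map_nonexpansive)

text \<open>The scaling has a free scalar: multiplying r and p by \<open>exp c\<close> and dividing
  s by it leaves the scaled matrices unchanged.\<close>

lemma log_p_shift: "log_p (\<lambda>i. \<rho> i + c) (\<lambda>j. \<sigma> j - c) $ k = log_p \<rho> \<sigma> $ k + c"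
proof -
  have "col_A (\<lambda>i. \<rho> i + c) k = col_A \<rho> k - c"
    unfolding col_A_def
    using Max_add_commute[of "{i. A $ i $ k \<noteq> 0}" "\<lambda>i. ln \<bar>A $ i $ k\<bar> - \<rho> i" "- c"] A_column_ex
    by (simp add: algebra_simps)
  moreover have "row_B (\<lambda>j. \<sigma> j - c) k = row_B \<sigma> k + c"
    unfolding row_B_def
    using Max_add_commute[of "{j. B $ k $ j \<noteq> 0}" "\<lambda>j. ln \<bar>B $ k $ j\<bar> - \<sigma> j" c] B_row_ex
    by (simp add: algebra_simps)
  ultimately show ?thesis unfolding log_p_def by (simp add: field_simps)
qed

lemma log_r_shift: "(\<And>k. v $ k = u $ k + c) \<Longrightarrow> log_r v i = log_r u i + c"
  unfolding log_r_def
  using Max_add_commute[of "{k. A $ i $ k \<noteq> 0}" "\<lambda>k. ln \<bar>A $ i $ k\<bar> + u $ k" c] A_row_ex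
  by (simp add: algebra_simps)

lemma log_s_shift: "(\<And>k. v $ k = u $ k + c) \<Longrightarrow> log_s v j = log_s u j - c"
  unfolding log_s_def
  using Max_add_commute[of "{k. B $ k $ j \<noteq> 0}" "\<lambda>k. ln \<bar>B $ k $ j\<bar> - u $ k" "- c"] B_column_ex
  by (simp add: algebra_simps)

lemma step_map_shift:
  assumes "\<And>k. v $ k = u $ k + c"
  shows "step_map v $ k = step_map u $ k + c"
  unfolding step_map_def using log_p_shift[of "log_r u" c "log_s u"] log_r_shift[OF assms] log_s_shift[OF assms]
  by (simp add: log_r_shift[OF assms, abs_def] log_s_shift[OF assms, abs_def])

lemma iterate_shift:
  assumes "\<And>k. v $ k = u $ k + c"
  shows "(step_map ^^ n) v $ k = (step_map ^^ n) u $ k + c"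
  using assms by (induction n arbitrary: k) (auto intro: step_map_shift)

lemma log_rs_shift: "(\<And>k. v $ k = u $ k + c) \<Longrightarrow> log_rs v i j = log_rs u i j"
  unfolding log_rs_def using log_r_shift log_s_shift by fastforce

lemma total_shift: "(\<And>k. v $ k = u $ k + c) \<Longrightarrow> total v = total u"
  unfolding total_def using log_rs_shift[of v u c] by simp

text \<open>If one step does not change any \<open>log_rs u i j = log_r u i + log_s u j\<close>, then it changes
  \<open>log_r\<close> and \<open>log_s\<close> by opposite constants, and from then on \<open>step_map\<close> acts as a translation.\<close>

lemma total_stationary:
  assumes "total (step_map u) = total u"
  shows "total ((step_map ^^ n) u) = total u"
proof -
  \<comment> \<open>No term can increase, so zero total decrease forces every term to stay
    fixed.\<close>
  have zeq: "log_rs (step_map u) i j = log_rs u i j" for i j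
  proof -
    have "(\<Sum>j\<in>UNIV. log_rs u i j - log_rs (step_map u) i j) = 0"
    proof -
      have "(\<Sum>i\<in>UNIV. \<Sum>j\<in>UNIV. log_rs u i j - log_rs (step_map u) i j) = 0"
        using assms unfolding total_def by (simp add: sum_subtractf)
      then show ?thesis
        by (subst (asm) sum_nonneg_eq_0_iff) (auto simp: log_rs_step_map_le intro!: sum_nonneg)
    qed
    then show ?thesis
      by (subst (asm) sum_nonneg_eq_0_iff) (auto simp: log_rs_step_map_le)
  qed
  obtain i0 :: 'm and j0 :: 'n where True by blast
  \<comment> \<open>The shift is read off at one row \<open>i0\<close>; comparing \<open>i0\<close>
    with every \<open>j\<close>, then \<open>j0\<close> with every \<open>i\<close>, shows that it
    is the same everywhere.\<close>
  define c where "c = log_r (step_map u) i0 - log_r u i0"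
  have s: "log_s (step_map u) j = log_s u j - c" for j
    using zeq[of i0 j] unfolding log_rs_def c_def by simp
  have r: "log_r (step_map u) i = log_r u i + c" for i
    using zeq[of i j0] s[of j0] unfolding log_rs_def by simp
  have step: "step_map (step_map u) $ k = step_map u $ k + c" for k
    unfolding step_map_def[of "step_map u"] using log_p_shift[of "log_r u" c "log_s u" k]
    by (simp add: step_map_def[of u, symmetric] r[abs_def] s[abs_def])
  have "total ((step_map ^^ n) (step_map u)) = total u" for n
  proof (induction n)
    case (Suc n)
    have "(step_map ^^ n) (step_map (step_map u)) $ k = (step_map ^^ n) (step_map u) $ k + c" for k
      by (rule iterate_shift[OF step])
    then have "total ((step_map ^^ n) (step_map (step_map u))) = total ((step_map ^^ n) (step_map u))"
      by (rule total_shift)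
    then show ?case using Suc by (simp add: funpow_swap1)
  qed (use assms in simp)
  then show ?thesis by (cases n) (auto simp: funpow_swap1)
qed

section \<open>The Lyapunov decrease, its error bound and geometric decay\<close>

lemma piecewise_affine_total_step_map: "piecewise_affine (\<lambda>u. total u - total (step_map u))"
proof -
  \<comment> \<open>The inner map \<open>g\<close> is arbitrary so that the identity and
    \<open>step_map\<close> are both covered.\<close>
  have r: "piecewise_affine (\<lambda>u. log_r (g u) i)"
    and s: "piecewise_affine (\<lambda>u. log_s (g u) j)"
    if "\<And>k. piecewise_affine (\<lambda>u. g u $ k)" for g :: "real^'k \<Rightarrow> real^'k" and i j
    unfolding log_r_def log_s_def using A_row_ex B_column_ex
    by (intro piecewise_affine_Max piecewise_affine_add piecewise_affine_diff
        piecewise_affine_const that; force)+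
  have total: "piecewise_affine (\<lambda>u. total (g u))"
    if "\<And>k. piecewise_affine (\<lambda>u. g u $ k)" for g :: "real^'k \<Rightarrow> real^'k"
    unfolding total_def log_rs_def by (intro piecewise_affine_sum piecewise_affine_add r s that finite)
  have "piecewise_affine (\<lambda>u. step_map u $ k)" for k
  proof -
    have "piecewise_affine (\<lambda>u. (1/2) * (row_B (log_s u) k - col_A (log_r u) k))"
      unfolding col_A_def row_B_def using A_column_ex B_row_ex
      by (intro piecewise_affine_cmult piecewise_affine_Max piecewise_affine_diff
          piecewise_affine_const r s piecewise_affine_component; force)
    then show ?thesis by (simp add: step_map_def log_p_def)
  qed
  then show ?thesis by (intro piecewise_affine_diff total piecewise_affine_component)
qed

text \<open>For nonzero \<open>A $ i $ k\<close> and \<open>B $ l $ j\<close>, term \<open>k\<close>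
  of \<open>log_r u i\<close> plus term \<open>l\<close> of \<open>log_s u j\<close> is at most
  \<open>Z\<close>, and this sum contains \<open>u $ k - u $ l\<close>. As \<open>W\<close> does not
  depend on \<open>u\<close>, a sublevel set lies in a box up to translation.\<close>

lemma oscillation_bound:
  obtains W where "\<And>u k l. (\<And>i j. log_rs u i j \<le> Z) \<Longrightarrow> u $ k - u $ l \<le> W"
proof -
  obtain i where i: "\<And>k. A $ i k $ k \<noteq> 0" using A_column_ex by metis
  obtain j where j: "\<And>k. B $ k $ j k \<noteq> 0" using B_row_ex by metis
  define w where "w = (\<lambda>(k, l). Z - ln \<bar>A $ i k $ k\<bar> - ln \<bar>B $ l $ j l\<bar>)"
  show ?thesis
  proof
    fix u :: "real^'k" and k l
    assume "\<And>i j. log_rs u i j \<le> Z"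
    then have "u $ k - u $ l \<le> w (k, l)"
      using log_r_ge[OF i, of k u] log_s_ge[OF j, of l u] unfolding log_rs_def w_def
      by (smt (verit) case_prod_conv)
    also have "\<dots> \<le> Max (range w)" by simp
    finally show "u $ k - u $ l \<le> Max (range w)" .
  qed
qed

text \<open>One nonzero entry in row \<open>i\<close> of \<open>A\<close> and one in column
  \<open>j\<close> of \<open>B\<close> bound \<open>log_rs u i j\<close> below up to a difference of
  coordinates of \<open>u\<close>, which is at least \<open>- W\<close>.\<close>

lemma log_rs_lower_bound:
  assumes "\<And>u k l. (\<And>i j. log_rs u i j \<le> Z) \<Longrightarrow> u $ k - u $ l \<le> W"
  obtains c where "\<And>u i j. (\<And>i j. log_rs u i j \<le> Z) \<Longrightarrow> c \<le> log_rs u i j"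
proof -
  obtain k where k: "\<And>i. A $ i $ k i \<noteq> 0" using A_row_ex by metis
  obtain l where l: "\<And>j. B $ l j $ j \<noteq> 0" using B_column_ex by metis
  define w where "w = (\<lambda>(i, j). ln \<bar>A $ i $ k i\<bar> + ln \<bar>B $ l j $ j\<bar> - W)"
  show ?thesis
  proof
    fix u :: "real^'k" and i j
    assume u: "\<And>i j. log_rs u i j \<le> Z"
    have "Min (range w) \<le> w (i, j)" by simp
    also have "\<dots> \<le> log_rs u i j"
      using log_r_ge[OF k, of i u] log_s_ge[OF l, of j u] assms[of u "l j" "k i", OF u]
      unfolding log_rs_def w_def by simp
    finally show "Min (range w) \<le> log_rs u i j" .
  qed
qed

lemma log_rs_iterate_le: "log_rs ((step_map ^^ n) u) i j \<le> log_rs u i j"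
  using decseqD[OF decseq_log_rs, of 0 n u i j] by simp

text \<open>The constant is uniform in \<open>u\<close> and in the horizon \<open>n\<close>. Either
  a stationary point is close to a translate of \<open>u\<close>, or the one-step decrease is
  bounded below.\<close>

lemma decrease_bound:
  obtains C where "0 \<le> C"
    "\<And>u n. (\<And>i j. log_rs u i j \<le> Z) \<Longrightarrow> total u - total ((step_map ^^ n) u) \<le> C * (total u - total (step_map u))"
proof -
  obtain W where W: "\<And>u k l. (\<And>i j. log_rs u i j \<le> Z) \<Longrightarrow> u $ k - u $ l \<le> W"
    using oscillation_bound by metis
  obtain c where c: "\<And>u i j. (\<And>i j. log_rs u i j \<le> Z) \<Longrightarrow> c \<le> log_rs u i j"
    using log_rs_lower_bound[OF W] by metis
  define N where "N = real CARD('m) * real CARD('n)"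
  define K where "K = (cbox (\<chi> k. - W) (\<chi> k. W) :: (real^'k) set)"
  have "polytope K" unfolding K_def by (rule polytope_interval)
  then have "\<exists>C\<ge>0. \<forall>x\<in>K. (\<exists>y. total y - total (step_map y) = 0 \<and> norm (x - y) \<le> C * (total x - total (step_map x)))
        \<or> 1 \<le> C * (total x - total (step_map x))"
    by (intro piecewise_affine_error_bound piecewise_affine_total_step_map) (simp add: total_step_map_le)
  then obtain C where C: "0 \<le> C"
    "\<And>x. x \<in> K \<Longrightarrow> (\<exists>y. total y - total (step_map y) = 0 \<and> norm (x - y) \<le> C * (total x - total (step_map x)))
        \<or> 1 \<le> C * (total x - total (step_map x))"
    by blast
  \<comment> \<open>\<open>N * 4\<close> comes from two Lipschitz estimates with constant
    \<open>N * 2\<close>, the other term from the range of \<open>total\<close> on the sublevel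
    set.\<close>
  define M where "M = max (N * 4) (N * \<bar>Z - c\<bar>)"
  have M: "0 \<le> M" "N * 4 \<le> M" "N * \<bar>Z - c\<bar> \<le> M"
    by (auto simp: M_def N_def le_max_iff_disj)
  define D where "D = C * M"
  obtain k0 :: 'k where True by blast
  show ?thesis
  proof
    show "0 \<le> D" using C(1) M(1) by (simp add: D_def)
    fix u n assume u: "\<And>i j. log_rs u i j \<le> Z"
    \<comment> \<open>Making coordinate \<open>k0\<close> vanish moves \<open>u\<close> into the box
      and keeps \<open>total\<close> along the orbit.\<close>
    define v where "v = (\<chi> k. u $ k - u $ k0)"
    have vu: "v $ k = u $ k + (- u $ k0)" for k by (simp add: v_def)
    have fv: "total ((step_map ^^ n) v) = total ((step_map ^^ n) u)" for n
      by (rule total_shift[OF iterate_shift[OF vu]])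
    have R: "total v - total (step_map v) = total u - total (step_map u)" using fv[of 0] fv[of 1] by simp
    have R0: "0 \<le> total u - total (step_map u)" using total_step_map_le by simp
    have "v \<in> K"
      unfolding K_def mem_box_cart
    proof (intro allI conjI)
      fix k
      show "(\<chi> k. - W) $ k \<le> v $ k" using W[OF u, of k0 k] by (simp add: v_def)
      show "v $ k \<le> (\<chi> k. W) $ k" using W[OF u, of k k0] by (simp add: v_def)
    qed
    then consider y where "total y - total (step_map y) = 0" "norm (v - y) \<le> C * (total u - total (step_map u))"
      | "1 \<le> C * (total u - total (step_map u))"
      using C(2)[of v] R by auto
    then show "total u - total ((step_map ^^ n) u) \<le> D * (total u - total (step_map u))"
    proof cases
      case 1
      have near: "\<bar>v $ k - y $ k\<bar> \<le> C * (total u - total (step_map u))" for k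
        using component_le_norm_cart[of "v - y" k] 1(2) by simp
      \<comment> \<open>The decrease from \<open>v\<close> is compared with that from
        \<open>y\<close>, which is zero; the two ends differ by one Lipschitz error each.\<close>
      have "\<bar>total v - total y\<bar> \<le> N * (2 * (C * (total u - total (step_map u))))"
        unfolding N_def by (rule total_lipschitz[OF near])
      moreover have "\<bar>total ((step_map ^^ n) v) - total ((step_map ^^ n) y)\<bar> \<le> N * (2 * (C * (total u - total (step_map u))))"
        unfolding N_def by (rule total_lipschitz[OF iterate_nonexpansive[OF near]])
      moreover have "total ((step_map ^^ n) y) = total y" using 1(1) by (intro total_stationary) simp
      ultimately have "total u - total ((step_map ^^ n) u) \<le> (N * 4) * (C * (total u - total (step_map u)))"
        using fv[of n] fv[of 0] by (simp add: algebra_simps)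
      also have "\<dots> \<le> M * (C * (total u - total (step_map u)))"
        using C(1) R0 M(2) by (intro mult_right_mono) auto
      finally show ?thesis by (simp add: D_def algebra_simps)
    next
      case 2
      \<comment> \<open>A large one-step decrease makes the crude bound on the variation of
        \<open>total\<close> sufficient.\<close>
      have "total u \<le> N * Z"
      proof -
        have "total u \<le> (\<Sum>i\<in>(UNIV::'m set). \<Sum>j\<in>(UNIV::'n set). Z)"
          unfolding total_def by (intro sum_mono u)
        then show ?thesis by (simp add: N_def)
      qed
      moreover have "N * c \<le> total ((step_map ^^ n) u)"
      proof -
        have "log_rs ((step_map ^^ n) u) i j \<le> Z" for i j using log_rs_iterate_le u order_trans by blast
        then have "(\<Sum>i\<in>(UNIV::'m set). \<Sum>j\<in>(UNIV::'n set). c) \<le> total ((step_map ^^ n) u)"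
          unfolding total_def by (intro sum_mono c)
        then show ?thesis by (simp add: N_def)
      qed
      ultimately have "total u - total ((step_map ^^ n) u) \<le> N * (Z - c)"
        by (simp add: algebra_simps)
      also have "\<dots> \<le> N * \<bar>Z - c\<bar>"
        unfolding N_def by (intro mult_left_mono) auto
      also have "\<dots> \<le> M * 1" using M(3) by simp
      also have "\<dots> \<le> M * (C * (total u - total (step_map u)))"
        using 2 M(1) by (rule mult_left_mono)
      finally show ?thesis by (simp add: D_def algebra_simps)
    qed
  qed
qed

text \<open>The remaining decrease of \<open>total\<close> is at most a fixed multiple of the next
  decrease, so it contracts by a fixed factor per step; every \<open>log_rs\<close> inherits this
  rate.\<close>

lemma log_rs_geometric:
  obtains L c q where "0 \<le> c" "0 < q" "q < 1" "\<And>n. L \<le> log_rs ((step_map ^^ n) u) i j"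
    "\<And>n. log_rs ((step_map ^^ n) u) i j - L \<le> c * q ^ n"
proof -
  \<comment> \<open>Monotonicity keeps the whole orbit below the initial maximum, so one constant
    serves every \<open>n\<close>.\<close>
  define Z where "Z = (MAX p\<in>UNIV. log_rs u (fst p) (snd p))"
  have zZ: "log_rs ((step_map ^^ n) u) i j \<le> Z" for n i j
    using log_rs_iterate_le[of n u i j] Max_image_ge[of UNIV "(i, j)" "\<lambda>p. log_rs u (fst p) (snd p)"]
    unfolding Z_def by simp
  obtain W where W: "\<And>u k l. (\<And>i j. log_rs u i j \<le> Z) \<Longrightarrow> u $ k - u $ l \<le> W"
    using oscillation_bound by metis
  obtain b where b: "\<And>u i j. (\<And>i j. log_rs u i j \<le> Z) \<Longrightarrow> b \<le> log_rs u i j"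
    using log_rs_lower_bound[OF W] by metis
  have "\<exists>L. (\<lambda>n. log_rs ((step_map ^^ n) u) i j) \<longlonglongrightarrow> L" for i j
    using decseq_convergent[OF decseq_log_rs[of u i j]] b[OF zZ] by metis
  then obtain L where L: "\<And>i j. (\<lambda>n. log_rs ((step_map ^^ n) u) i j) \<longlonglongrightarrow> L i j"
    by metis
  have L_le: "L i j \<le> log_rs ((step_map ^^ n) u) i j" for i j n
    using decseq_ge[OF decseq_log_rs L] .
  define F where "F = (\<Sum>i\<in>UNIV. \<Sum>j\<in>UNIV. L i j)"
  define e where "e n = total ((step_map ^^ n) u) - F" for n
  have F: "(\<lambda>n. total ((step_map ^^ n) u)) \<longlonglongrightarrow> F"
    unfolding total_def F_def by (intro tendsto_sum L)
  \<comment> \<open>The left side is one summand of \<open>e n\<close>, all of whose summands are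
    nonnegative.\<close>
  have log_rs_e: "log_rs ((step_map ^^ n) u) i j - L i j \<le> e n" for i j n
  proof -
    have "log_rs ((step_map ^^ n) u) i j - L i j \<le> (\<Sum>j\<in>UNIV. log_rs ((step_map ^^ n) u) i j - L i j)"
      using L_le by (intro member_le_sum) auto
    also have "\<dots> \<le> (\<Sum>i\<in>UNIV. \<Sum>j\<in>UNIV. log_rs ((step_map ^^ n) u) i j - L i j)"
      using L_le by (intro member_le_sum[of i]) (auto intro!: sum_nonneg)
    also have "\<dots> = e n"
      by (simp add: e_def total_def F_def sum_subtractf)
    finally show ?thesis .
  qed
  have e0: "0 \<le> e n" for n using log_rs_e[of n i j] L_le[of i j n] by linarith
  obtain C where C: "0 \<le> C"
    "\<And>u n. (\<And>i j. log_rs u i j \<le> Z) \<Longrightarrow> total u - total ((step_map ^^ n) u) \<le> C * (total u - total (step_map u))"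
    using decrease_bound by metis
  \<comment> \<open>The horizon in \<open>decrease_bound\<close> is sent to infinity.\<close>
  have gap: "e n \<le> C * (e n - e (Suc n))" for n
  proof -
    have "(\<lambda>m. total ((step_map ^^ (m + n)) u)) \<longlonglongrightarrow> F"
      using F by (rule LIMSEQ_ignore_initial_segment)
    then have "(\<lambda>m. total ((step_map ^^ n) u) - total ((step_map ^^ (m + n)) u)) \<longlonglongrightarrow> e n"
      unfolding e_def by (intro tendsto_intros)
    moreover have "total ((step_map ^^ n) u) - total ((step_map ^^ (m + n)) u) \<le> C * (e n - e (Suc n))" for m
      using C(2)[of "(step_map ^^ n) u" m, OF zZ] by (simp add: e_def funpow_add)
    ultimately show ?thesis by (intro LIMSEQ_le_const2) auto
  qed
  \<comment> \<open>Adding 2 keeps \<open>q\<close> positive even for \<open>C = 0\<close>.\<close>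
  define q where "q = 1 - 1 / (C + 2)"
  have q: "0 < q" "q < 1" using C(1) by (auto simp: q_def field_simps)
  have step: "e (Suc n) \<le> q * e n" for n
  proof -
    have "e (Suc n) \<le> e n" using total_step_map_le by (simp add: e_def)
    then have "e n \<le> (C + 2) * (e n - e (Suc n))"
      using gap[of n] by (simp add: algebra_simps)
    then have "e n / (C + 2) \<le> e n - e (Suc n)"
      using C(1) by (simp add: pos_divide_le_eq mult.commute)
    then show ?thesis by (simp add: q_def algebra_simps)
  qed
  have decay: "e n \<le> e 0 * q ^ n" for n
  proof (induction n)
    case (Suc n)
    have "e (Suc n) \<le> q * e n" by (rule step)
    also have "\<dots> \<le> q * (e 0 * q ^ n)" using Suc q by simp
    finally show ?case by (simp add: algebra_simps)
  qed simp
  show ?thesis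
    by (rule that[OF e0[of 0] q L_le[of i j]]) (rule order_trans[OF log_rs_e decay])
qed

section \<open>The iteration in logarithmic coordinates\<close>

text \<open>The state does not store the accumulated inside scaling, so the invariant supplies it as
  \<open>exp u\<close>.\<close>

definition scaled_by :: "('m, 'k, 'n) scaling_state \<Rightarrow> real^'k \<Rightarrow> bool" where
  "scaled_by S u \<longleftrightarrow> (\<forall>i. 0 < scale_r S $ i) \<and> (\<forall>j. 0 < scale_s S $ j)
    \<and> (\<forall>i k. mat_A S $ i $ k = A $ i $ k * exp (u $ k) / scale_r S $ i)
    \<and> (\<forall>k j. mat_B S $ k $ j = B $ k $ j / (exp (u $ k) * scale_s S $ j))"

definition objective :: "('m, 'k, 'n) scaling_state \<Rightarrow> 'm \<Rightarrow> 'n \<Rightarrow> real" where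
  "objective S i j = scale_r S $ i * scale_s S $ j * max_norm (mat_A S) * max_norm (mat_B S)"

lemma scaled_by_init: "scaled_by (init_state A B) 0"
  by (simp add: scaled_by_def init_state_def)

text \<open>All logarithms in the maximum are shifted by the same constant, which can be pulled out.
  The next three lemmas work alike; across the outside factors the constant is \<open>u $ k\<close>
  or its negative.\<close>

lemma row_max_A:
  assumes "scaled_by S u"
  shows "(MAX k. \<bar>mat_A S $ i $ k\<bar>) = exp (log_r u i) / scale_r S $ i"
proof -
  let ?g = "\<lambda>k. \<bar>mat_A S $ i $ k\<bar>" and ?I = "{k. A $ i $ k \<noteq> 0}"
  have r: "0 < scale_r S $ i" using assms by (simp add: scaled_by_def)
  have g: "?g k = \<bar>A $ i $ k\<bar> * exp (u $ k) / scale_r S $ i" for k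
    using assms abs_of_pos[OF r] by (simp add: scaled_by_def abs_mult)
  have I: "{k. ?g k \<noteq> 0} = ?I" using r by (auto simp: g)
  obtain k0 where k0: "A $ i $ k0 \<noteq> 0" using A_row_ex by blast
  have "(MAX k. ?g k) = exp (MAX k\<in>?I. ln (?g k))"
    using Max_image_eq_exp[of ?g k0] k0 I by auto
  also have "(MAX k\<in>?I. ln (?g k)) = (MAX k\<in>?I. (ln \<bar>A $ i $ k\<bar> + u $ k) + - ln (scale_r S $ i))"
    using r by (intro arg_cong[where f = Max] image_cong) (auto simp: g ln_mult ln_div)
  also have "\<dots> = log_r u i + - ln (scale_r S $ i)"
    unfolding log_r_def using k0 by (intro Max_add_commute) auto
  finally show ?thesis using r by (simp add: exp_diff)
qed

lemma column_max_B:
  assumes "scaled_by S u"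
  shows "(MAX k. \<bar>mat_B S $ k $ j\<bar>) = exp (log_s u j) / scale_s S $ j"
proof -
  let ?g = "\<lambda>k. \<bar>mat_B S $ k $ j\<bar>" and ?I = "{k. B $ k $ j \<noteq> 0}"
  have s: "0 < scale_s S $ j" using assms by (simp add: scaled_by_def)
  have g: "?g k = \<bar>B $ k $ j\<bar> / (exp (u $ k) * scale_s S $ j)" for k
    using assms abs_of_pos[OF s] by (simp add: scaled_by_def abs_mult)
  have I: "{k. ?g k \<noteq> 0} = ?I" using s by (auto simp: g)
  obtain k0 where k0: "B $ k0 $ j \<noteq> 0" using B_column_ex by blast
  have "(MAX k. ?g k) = exp (MAX k\<in>?I. ln (?g k))"
    using Max_image_eq_exp[of ?g k0] k0 I by auto
  also have "(MAX k\<in>?I. ln (?g k)) = (MAX k\<in>?I. (ln \<bar>B $ k $ j\<bar> - u $ k) + - ln (scale_s S $ j))"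
    using s by (intro arg_cong[where f = Max] image_cong) (auto simp: g ln_mult ln_div)
  also have "\<dots> = log_s u j + - ln (scale_s S $ j)"
    unfolding log_s_def using k0 by (intro Max_add_commute) auto
  finally show ?thesis using s by (simp add: exp_diff)
qed

lemma column_max_A:
  assumes "scaled_by S u"
  shows "(MAX i. \<bar>mat_A S $ i $ k\<bar>) = exp (col_A (\<lambda>i. ln (scale_r S $ i)) k + u $ k)"
proof -
  let ?g = "\<lambda>i. \<bar>mat_A S $ i $ k\<bar>" and ?I = "{i. A $ i $ k \<noteq> 0}"
  have r: "0 < scale_r S $ i" for i using assms by (simp add: scaled_by_def)
  then have r0: "scale_r S $ i \<noteq> 0" for i by (metis less_irrefl)
  have g: "?g i = \<bar>A $ i $ k\<bar> * exp (u $ k) / scale_r S $ i" for i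
    using assms abs_of_pos[OF r[of i]] by (simp add: scaled_by_def abs_mult)
  have I: "{i. ?g i \<noteq> 0} = ?I" by (auto simp: g r0)
  obtain i0 where i0: "A $ i0 $ k \<noteq> 0" using A_column_ex by blast
  have "(MAX i. ?g i) = exp (MAX i\<in>?I. ln (?g i))"
    using Max_image_eq_exp[of ?g i0] i0 I by auto
  also have "(MAX i\<in>?I. ln (?g i)) = (MAX i\<in>?I. (ln \<bar>A $ i $ k\<bar> - ln (scale_r S $ i)) + u $ k)"
    using r by (intro arg_cong[where f = Max] image_cong) (auto simp: g ln_mult ln_div r0)
  also have "\<dots> = col_A (\<lambda>i. ln (scale_r S $ i)) k + u $ k"
    unfolding col_A_def using i0 by (intro Max_add_commute) auto
  finally show ?thesis .
qed

lemma row_max_B: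
  assumes "scaled_by S u"
  shows "(MAX j. \<bar>mat_B S $ k $ j\<bar>) = exp (row_B (\<lambda>j. ln (scale_s S $ j)) k - u $ k)"
proof -
  let ?g = "\<lambda>j. \<bar>mat_B S $ k $ j\<bar>" and ?I = "{j. B $ k $ j \<noteq> 0}"
  have s: "0 < scale_s S $ j" for j using assms by (simp add: scaled_by_def)
  then have s0: "scale_s S $ j \<noteq> 0" for j by (metis less_irrefl)
  have g: "?g j = \<bar>B $ k $ j\<bar> / (exp (u $ k) * scale_s S $ j)" for j
    using assms abs_of_pos[OF s[of j]] by (simp add: scaled_by_def abs_mult)
  have I: "{j. ?g j \<noteq> 0} = ?I" by (auto simp: g s0)
  obtain j0 where j0: "B $ k $ j0 \<noteq> 0" using B_row_ex by blast
  have "(MAX j. ?g j) = exp (MAX j\<in>?I. ln (?g j))"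
    using Max_image_eq_exp[of ?g j0] j0 I by auto
  also have "(MAX j\<in>?I. ln (?g j)) = (MAX j\<in>?I. (ln \<bar>B $ k $ j\<bar> - ln (scale_s S $ j)) + - u $ k)"
    using s by (intro arg_cong[where f = Max] image_cong) (auto simp: g ln_mult ln_div s0)
  also have "\<dots> = row_B (\<lambda>j. ln (scale_s S $ j)) k + - u $ k"
    unfolding row_B_def using j0 by (intro Max_add_commute) auto
  finally show ?thesis by simp
qed

text \<open>The old outside factors cancel against those in the row and column maxima, so the new
  ones depend on \<open>u\<close> alone.\<close>

lemma outside_step_scaled:
  assumes "scaled_by S u"
  shows "scaled_by (outside_step S) u"
    and "scale_r (outside_step S) $ i = exp (log_r u i)"
    and "scale_s (outside_step S) $ j = exp (log_s u j)"
proof -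
  have pos: "0 < scale_r S $ i" "0 < scale_s S $ j" for i j
    using assms by (auto simp: scaled_by_def)
  have r: "scale_r (outside_step S) $ i = exp (log_r u i)" for i
    using pos(1)[of i] by (simp add: outside_step_def Let_def row_max_A[OF assms])
  have s: "scale_s (outside_step S) $ j = exp (log_s u j)" for j
    using pos(2)[of j] by (simp add: outside_step_def Let_def column_max_B[OF assms])
  have "mat_A (outside_step S) $ i $ k = A $ i $ k * exp (u $ k) / exp (log_r u i)" for i k
  proof -
    have "mat_A S $ i $ k = A $ i $ k * exp (u $ k) / scale_r S $ i"
      using assms by (simp add: scaled_by_def)
    then show ?thesis
      using pos(1)[of i] by (simp add: outside_step_def Let_def row_max_A[OF assms])
  qed
  moreover have "mat_B (outside_step S) $ k $ j = B $ k $ j / (exp (u $ k) * exp (log_s u j))" for k j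
  proof -
    have "mat_B S $ k $ j = B $ k $ j / (exp (u $ k) * scale_s S $ j)"
      using assms by (simp add: scaled_by_def)
    then show ?thesis
      using pos(2)[of j] by (simp add: outside_step_def Let_def column_max_B[OF assms])
  qed
  ultimately show "scaled_by (outside_step S) u"
    by (simp add: scaled_by_def r s)
  show "scale_r (outside_step S) $ i = exp (log_r u i)"
    "scale_s (outside_step S) $ j = exp (log_s u j)" by (rule r s)+
qed

lemma sqrt_exp: "sqrt (exp x) = exp (x / 2)"
  by (rule real_sqrt_unique) (simp_all add: power2_eq_square exp_add[symmetric])

text \<open>The step factor is \<open>exp (?v $ k) / exp (u $ k)\<close>, so the old inside scaling
  cancels and the new one depends on the outside factors alone.\<close>

lemma inside_step_scaled:
  assumes "scaled_by S u"
  shows "scaled_by (inside_step S) (log_p (\<lambda>i. ln (scale_r S $ i)) (\<lambda>j. ln (scale_s S $ j)))"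
    and "scale_r (inside_step S) = scale_r S" and "scale_s (inside_step S) = scale_s S"
proof -
  let ?v = "log_p (\<lambda>i. ln (scale_r S $ i)) (\<lambda>j. ln (scale_s S $ j))"
  have p: "sqrt ((MAX j. \<bar>mat_B S $ k $ j\<bar>) / (MAX i. \<bar>mat_A S $ i $ k\<bar>)) = exp (?v $ k) / exp (u $ k)"
    for k
    unfolding row_max_B[OF assms] column_max_A[OF assms] exp_diff[symmetric] sqrt_exp
    by (simp add: log_p_def field_simps)
  show "scale_r (inside_step S) = scale_r S" "scale_s (inside_step S) = scale_s S"
    by (simp_all add: inside_step_def Let_def)
  then show "scaled_by (inside_step S) ?v"
    using assms unfolding scaled_by_def inside_step_def Let_def p by simp
qed

section \<open>Monotonicity of the objective\<close>

lemma objective_outside_step: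
  assumes "scaled_by S u"
  shows "objective (outside_step S) i j = exp (log_rs u i j)"
proof -
  note S' = outside_step_scaled[OF assms]
  \<comment> \<open>The row maximum formula, applied to the new state with its factors
    \<open>exp (log_r u i)\<close>, gives 1 in every row.\<close>
  have "max_norm (mat_A (outside_step S)) = 1"
    unfolding max_norm_rows row_max_A[OF S'(1)] S'(2) by simp
  moreover have "max_norm (mat_B (outside_step S)) = 1"
    unfolding max_norm_columns column_max_B[OF S'(1)] S'(3) by simp
  ultimately show ?thesis
    by (simp add: objective_def S'(2,3) log_rs_def exp_add)
qed

text \<open>Each outside factor grows by a row or column maximum, which is at most the norm that the
  step turns into 1.\<close>

lemma objective_outside_step_le:
  assumes "scaled_by S u"
  shows "objective (outside_step S) i j \<le> objective S i j"
proof -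
  have pos: "0 < scale_r S $ i" "0 < scale_s S $ j"
    using assms by (auto simp: scaled_by_def)
  have "exp (log_r u i) / scale_r S $ i \<le> max_norm (mat_A S)"
    unfolding max_norm_rows row_max_A[OF assms, symmetric] by simp
  then have r: "exp (log_r u i) \<le> scale_r S $ i * max_norm (mat_A S)"
    using pos by (simp add: pos_divide_le_eq mult.commute)
  have "exp (log_s u j) / scale_s S $ j \<le> max_norm (mat_B S)"
    unfolding max_norm_columns column_max_B[OF assms, symmetric] by simp
  then have s: "exp (log_s u j) \<le> scale_s S $ j * max_norm (mat_B S)"
    using pos by (simp add: pos_divide_le_eq mult.commute)
  have "exp (log_r u i) * exp (log_s u j)
      \<le> (scale_r S $ i * max_norm (mat_A S)) * (scale_s S $ j * max_norm (mat_B S))"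
    using r s order_trans[OF exp_ge_zero r] by (intro mult_mono) auto
  then show ?thesis
    unfolding objective_outside_step[OF assms] by (simp add: objective_def log_rs_def exp_add algebra_simps)
qed

text \<open>An inside step makes the \<open>k\<close>-th column maximum of the first matrix and the \<open>k\<close>-th row maximum
  of the second both equal to their previous geometric mean.\<close>

lemma objective_inside_step_le:
  assumes "scaled_by S u"
  shows "objective (inside_step S) i j \<le> objective S i j"
proof -
  note S' = inside_step_scaled[OF assms]
  define a where "a = col_A (\<lambda>i. ln (scale_r S $ i))"
  define b where "b = row_B (\<lambda>j. ln (scale_s S $ j))"
  define h where "h k = exp ((a k + b k) / 2)" for k
  have pos: "0 < scale_r S $ i" "0 < scale_s S $ j"
    using assms by (auto simp: scaled_by_def)
  have A': "max_norm (mat_A (inside_step S)) = (MAX k. h k)"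
    unfolding max_norm_columns column_max_A[OF S'(1)] S'(2)
    by (simp add: h_def log_p_def a_def b_def field_simps)
  have B': "max_norm (mat_B (inside_step S)) = (MAX k. h k)"
    unfolding max_norm_rows row_max_B[OF S'(1)] S'(3)
    by (simp add: h_def log_p_def a_def b_def field_simps)
  \<comment> \<open>Both norms are the same maximum, so their product is a square at one common
    index \<open>k\<close>.\<close>
  have "(MAX k. h k) \<in> range h" by (intro Max_in) auto
  then obtain k where k: "(MAX k. h k) = h k" by (rule rangeE)
  have "h k * h k = exp (a k + u $ k) * exp (b k - u $ k)"
    unfolding h_def exp_add[symmetric] by simp
  also have "\<dots> \<le> max_norm (mat_A S) * max_norm (mat_B S)"
  proof (rule mult_mono)
    show "exp (a k + u $ k) \<le> max_norm (mat_A S)"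
      unfolding a_def column_max_A[OF assms, symmetric] max_norm_columns by simp
    then show "0 \<le> max_norm (mat_A S)" by (rule order_trans[OF exp_ge_zero])
    show "exp (b k - u $ k) \<le> max_norm (mat_B S)"
      unfolding b_def row_max_B[OF assms, symmetric] max_norm_rows by simp
  qed simp
  finally have "h k * h k \<le> max_norm (mat_A S) * max_norm (mat_B S)" .
  then have "scale_r S $ i * scale_s S $ j * (h k * h k)
      \<le> scale_r S $ i * scale_s S $ j * (max_norm (mat_A S) * max_norm (mat_B S))"
    using pos by (intro mult_left_mono) auto
  then show ?thesis
    by (simp add: objective_def A' B' k S'(2,3) mult.assoc)
qed

section \<open>Linear convergence along the iteration\<close>

lemma scaling_iter_scaled: "\<exists>u. scaled_by (scaling_iter is_O A B t) u"
  by (induction t) (auto intro: scaled_by_init outside_step_scaled(1) inside_step_scaled(1))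

lemma decseq_objective: "decseq (\<lambda>t. objective (scaling_iter is_O A B t) i j)"
proof (rule decseq_SucI)
  fix t
  obtain u where "scaled_by (scaling_iter is_O A B t) u" using scaling_iter_scaled by blast
  then show "objective (scaling_iter is_O A B (Suc t)) i j \<le> objective (scaling_iter is_O A B t) i j"
    by (simp add: objective_outside_step_le objective_inside_step_le)
qed

lemma converges_linearly_objective:
  assumes "alternating is_O"
  shows "converges_linearly (\<lambda>t. objective (scaling_iter is_O A B t) i j)"
proof -
  let ?S = "scaling_iter is_O A B"
  have alt: "is_O (Suc (Suc t)) \<longleftrightarrow> \<not> is_O (Suc t)" for t
    using assms unfolding alternating_def by simp
  \<comment> \<open>Exactly one of steps 1 and 2 is an O step, whichever type comes first.\<close>
  obtain t0 where t0: "is_O (Suc t0)" using alt[of 0] by blast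
  have O: "is_O (Suc (t0 + 2 * n))" for n
    by (induction n) (use t0 alt in auto)
  obtain u where u: "scaled_by (?S t0) u" using scaling_iter_scaled by blast
  \<comment> \<open>The states are sampled just before O steps, where two further steps amount to
    \<open>step_map\<close>.\<close>
  have even: "scaled_by (?S (t0 + 2 * n)) ((step_map ^^ n) u)" for n
  proof (induction n)
    case (Suc n)
    note S' = outside_step_scaled[OF Suc]
    have "scaled_by (inside_step (outside_step (?S (t0 + 2 * n)))) (step_map ((step_map ^^ n) u))"
      using inside_step_scaled(1)[OF S'(1)] by (simp add: S'(2,3) step_map_def[of "(step_map ^^ n) u"])
    then show ?case using O[of n] alt by simp
  qed (use u in simp)
  have obj: "objective (?S (Suc t0 + 2 * n)) i j = exp (log_rs ((step_map ^^ n) u) i j)" for n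
    using objective_outside_step[OF even] O by simp
  obtain L c q where L: "0 \<le> c" "0 < q" "q < 1" "\<And>n. L \<le> log_rs ((step_map ^^ n) u) i j"
    "\<And>n. log_rs ((step_map ^^ n) u) i j - L \<le> c * q ^ n"
    using log_rs_geometric by metis
  show ?thesis
  proof (rule converges_linearly_of_every_second[OF decseq_objective])
    show "exp L \<le> objective (?S (Suc t0 + 2 * n)) i j" for n
      unfolding obj using L(4) by simp
    show "objective (?S (Suc t0 + 2 * n)) i j - exp L \<le> (exp (log_rs u i j) * c) * q ^ n" for n
    proof -
      \<comment> \<open>The tangent bound \<open>1 + x \<le> exp x\<close> passes from logarithms
        back to the objective; monotonicity bounds the factor \<open>exp y\<close> by its initial
        value.\<close>
      define y where "y = log_rs ((step_map ^^ n) u) i j"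
      have "exp y - exp L = exp y * (1 - exp (L - y))"
        by (simp add: algebra_simps exp_add[symmetric])
      also have "\<dots> \<le> exp y * (y - L)"
        using exp_ge_add_one_self[of "L - y"] by (intro mult_left_mono exp_ge_zero) linarith
      also have "\<dots> \<le> exp (log_rs u i j) * (c * q ^ n)"
        using L(4,5)[of n] log_rs_iterate_le[of n u i j] unfolding y_def by (intro mult_mono) auto
      finally show ?thesis unfolding obj y_def by (simp add: mult.assoc)
    qed
    show "0 \<le> exp (log_rs u i j) * c" using L(1) by simp
  qed (use L in auto)
qed

end

theorem theorem6p6:
  fixes A :: "real^'k^'m" and B :: "real^'n^'k"
    and is_O :: "nat \<Rightarrow> bool"
    and i :: 'm and j :: 'n
  assumes "no_zero_rows A" and "no_zero_columns A"
    and "no_zero_rows B" and "no_zero_columns B"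
    and "alternating is_O"
  shows "let S = scaling_iter is_O A B;
             x = (\<lambda>t. scale_r (S t) $ i * scale_s (S t) $ j
                     * max_norm (mat_A (S t)) * max_norm (mat_B (S t)))
         in decseq x \<and> converges_linearly x"
proof -
  interpret scaling_pair A B using assms(1-4) by unfold_locales
  show ?thesis
    using decseq_objective[of is_O i j] converges_linearly_objective[OF assms(5), of i j]
    unfolding objective_def Let_def by blast
qed

end
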